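(* Let $n,k\ge 0$ be integers with $n\ge k-1$. Then $$A_{n,k}(x,y)=\sum_{\lambda\in A_{n,k}}x^{|\lambda_o|}y^{|\lambda_e|}=\frac{\begin{bmatrix} n\\ \lfloor k/2\rfloor\end{bmatrix}_{xy}}{(x;xy)_{\lceil k/2\rceil}\,(x^{n-k+1}y^{n-k+2};xy)_{\lfloor k/2\rfloor}}.$$
   Context: For $n\ge k-1$, $A_{n,k}$ is the set of truncated anti-lecture hall compositions: sequences $\lambda=(\lambda_1,\ldots,\lambda_k)$ of nonnegative integers with $$\frac{\lambda_1}{n-k+1}\ge\frac{\lambda_2}{n-k+2}\ge\cdots\ge\frac{\lambda_k}{n}\ge 0.$$ When $n=k-1$ the first denominator is $0$; by convention the first inequality is then always valid for $\lambda_1\ge0$ (so $\lambda_1$ is an arbitrary nonnegative integer and the remaining parts satisfy the remaining inequalities). For $k=0$ the set consists of the empty sequence only. For such $\lambda$, $\lambda_o=(\lambda_1,\lambda_3,\ldots)$ and $\lambda_e=(\lambda_2,\lambda_4,\ldots)$, and $|\cdot|$ denotes the sum of the entries of a sequence. Notation: $(a;q)_m=\prod_{i=0}^{m-1}(1-aq^i)$ and $\begin{bmatrix} N\\ m\end{bmatrix}_q=(q^{N-m+1};q)_m/(q;q)_m$ (Gaussian polynomial). The identity is between formal power series in $x,y$. *)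

theory Defs
  imports "HOL-Computational_Algebra.Formal_Power_Series"
begin

text \<open>
  The part \<open>\<lambda>\<^sub>j\<close> (\<open>1 \<le> j \<le> k\<close>) is the list entry \<open>l ! (j - 1)\<close>; its denominator is \<open>n - k + j\<close>.
  The disjunct \<open>n + j = k\<close> says that this denominator vanishes, which for \<open>n \<ge> k - 1\<close> happens
  exactly for \<open>n = k - 1\<close>, \<open>j = 1\<close>; the inequality is then void by convention
  (the HOL convention \<open>a / 0 = 0\<close> would instead force \<open>\<lambda>\<^sub>2 = 0\<close>).
  The final inequality \<open>\<lambda>\<^sub>k / n \<ge> 0\<close> is automatic for natural numbers.
\<close>

definition al_denom :: "nat \<Rightarrow> nat \<Rightarrow> nat \<Rightarrow> rat" where
  "al_denom n k j = of_nat n - of_nat k + of_nat j"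

definition truncated_anti_lecture_hall :: "nat \<Rightarrow> nat \<Rightarrow> nat list set" where
  "truncated_anti_lecture_hall n k =
     {l. length l = k \<and>
         (\<forall>j\<in>{1..<k}. n + j = k \<or>
            of_nat (l ! (j - 1)) / al_denom n k j \<ge> of_nat (l ! j) / al_denom n k (j + 1))}"

text \<open>Odd-indexed parts \<open>\<lambda>\<^sub>1, \<lambda>\<^sub>3, \<dots>\<close> sit at even list positions, and vice versa.\<close>

definition odd_parts :: "nat list \<Rightarrow> nat list" where
  "odd_parts l = nths l {i. even i}"

definition even_parts :: "nat list \<Rightarrow> nat list" where
  "even_parts l = nths l {i. odd i}"

text \<open>
  Formal power series in two variables are series in \<open>x\<close> whose coefficients are series in \<open>y\<close>:
  the coefficient of \<open>x\<^sup>i y\<^sup>j\<close> in \<open>F\<close> is \<open>fps_nth (fps_nth F i) j\<close>.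
\<close>

type_synonym fps2 = "rat fps fps"

definition X :: fps2 where "X = fps_X"
definition Y :: fps2 where "Y = fps_const fps_X"

text \<open>
  The sum of \<open>x\<^bsup>a l\<^esup> y\<^bsup>b l\<^esup>\<close> over \<open>l \<in> S\<close>, for \<open>S\<close> containing only finitely many \<open>l\<close> with given
  \<open>a l\<close> and \<open>b l\<close>. It is defined coefficientwise, because for infinite \<open>S\<close> the sum need not
  converge in the topology that the library puts on iterated power series.
\<close>

definition gen_fun :: "'a set \<Rightarrow> ('a \<Rightarrow> nat) \<Rightarrow> ('a \<Rightarrow> nat) \<Rightarrow> fps2" where
  "gen_fun S a b = Abs_fps (\<lambda>i. Abs_fps (\<lambda>j. of_nat (card {l \<in> S. a l = i \<and> b l = j})))"

definition anti_lecture_hall_gf :: "nat \<Rightarrow> nat \<Rightarrow> fps2" where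
  "anti_lecture_hall_gf n k =
     gen_fun (truncated_anti_lecture_hall n k)
       (\<lambda>l. sum_list (odd_parts l)) (\<lambda>l. sum_list (even_parts l))"

definition qpochhammer :: "'a::comm_ring_1 \<Rightarrow> 'a \<Rightarrow> nat \<Rightarrow> 'a" where
  "qpochhammer a q m = (\<Prod>i<m. 1 - a * q ^ i)"

text \<open>Intended for \<open>m \<le> N + 1\<close>, where the natural-number subtraction does not truncate.\<close>

definition gauss_binomial :: "nat \<Rightarrow> nat \<Rightarrow> 'a::{comm_ring_1, divide} \<Rightarrow> 'a" where
  "gauss_binomial N m q = qpochhammer (q ^ (N + 1 - m)) q m div qpochhammer q q m"

text \<open>The sets counted by the generating function are finite.\<close>

lemma sum_list_odd_even_parts:
  "sum_list (odd_parts l) + sum_list (even_parts l) = sum_list l"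
proof (induction l)
  case Nil
  then show ?case by (simp add: odd_parts_def even_parts_def)
next
  case (Cons a l)
  then show ?case by (simp add: odd_parts_def even_parts_def nths_Cons)
qed

lemma finite_anti_lecture_hall_level:
  "finite {l \<in> truncated_anti_lecture_hall n k.
             sum_list (odd_parts l) = i \<and> sum_list (even_parts l) = j}"
proof (rule finite_subset)
  show "{l \<in> truncated_anti_lecture_hall n k.
             sum_list (odd_parts l) = i \<and> sum_list (even_parts l) = j}
          \<subseteq> {l. set l \<subseteq> {..i + j} \<and> length l = k}"
    using sum_list_odd_even_parts member_le_sum_list
    by (fastforce simp: truncated_anti_lecture_hall_def)
  show "finite {l. set l \<subseteq> {..i + j} \<and> length l = k}"
    by (rule finite_lists_length_eq) simp
qed

text \<open>Division by a series with nonzero constant term is the genuine one.\<close>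

lemma fps2_divide_unit:
  fixes F G :: fps2
  assumes "fps_nth (fps_nth G 0) 0 \<noteq> 0"
  shows "F / G * G = F"
proof -
  have "inverse (fps_nth G 0) * fps_nth G 0 = 1"
    using assms by (simp add: inverse_mult_eq_1)
  then have "G * inverse G = 1"
    unfolding fps_inverse_def[of G] by (intro fps_right_inverse) (simp add: mult.commute)
  moreover have "subdegree G = 0"
    using assms by (intro subdegree_eq_0) auto
  ultimately show ?thesis
    by (simp add: fps_divide_def mult.assoc mult.commute[of _ G])
qed

end

theory Submission
  imports Defs "HOL-Library.Product_Plus"
begin

text \<open>
  Write \<open>m = n - k + 1\<close> and \<open>F\<^sub>m\<^sub>,\<^sub>k(x, y)\<close> for the generating function, so that the denominators are
  \<open>m, ..., m + k - 1\<close>. Remove \<open>\<lambda>\<^sub>1\<close>, keeping its excess over the smallest value allowed by \<open>\<lambda>\<^sub>2\<close>,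
  and reflect each of \<open>\<lambda>\<^sub>3, \<lambda>\<^sub>5, ...\<close> in the interval to which its neighbours confine it. The floors
  in the bounds of these intervals telescope. For odd \<open>k\<close> they cancel completely, and
  \<open>(1 - x) F\<^sub>m\<^sub>,\<^sub>k(x, y) = F\<^bsub>m+1,k-1\<^esub>(x\<^sup>2y, 1/x)\<close>. For even \<open>k\<close> the largest value that could be
  appended to the remaining sequence is left over; comparing it with the excess of \<open>\<lambda>\<^sub>1\<close> gives
  \<open>(1 - x) F\<^sub>m\<^sub>,\<^sub>k(x, y) = (1 - x) F\<^bsub>m+1,k\<^esub>(x\<^sup>2y, 1/x) + x F\<^bsub>m+1,k-1\<^esub>(x\<^sup>2y, 1/x)\<close>.
  Together with \<open>(1 - x) F\<^bsub>0,k\<^esub>(x, y) = F\<^bsub>1,k-1\<^esub>(y, x)\<close> this determines all \<open>F\<^sub>m\<^sub>,\<^sub>k\<close>, and the product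
  satisfies the same recurrences, since the substitution fixes \<open>xy\<close>.
\<close>

unbundle fps_syntax

section \<open>Monomial substitutions\<close>

text \<open>Extending by zero to all integer exponents lets a Laurent substitution act as a linear
  map on exponent vectors.\<close>

definition coeff2 :: "fps2 \<Rightarrow> int \<times> int \<Rightarrow> rat" where
  "coeff2 F = (\<lambda>(i, j). if i \<ge> 0 \<and> j \<ge> 0 then F $ nat i $ nat j else 0)"

definition mono2 :: "nat \<Rightarrow> nat \<Rightarrow> fps2" where
  "mono2 i j = X ^ i * Y ^ j"

lemma mono2_mult: "mono2 i j * mono2 i' j' = mono2 (i + i') (j + j')"
  by (simp add: mono2_def power_add mult_ac)

lemma mono2_power: "mono2 i j ^ r = mono2 (r * i) (r * j)"
  by (simp add: mono2_def power_mult_distrib power_mult mult.commute flip: power_mult)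

lemma coeff2_eqI: "(\<And>u. coeff2 F u = coeff2 G u) \<Longrightarrow> F = G"
proof (intro fps_ext)
  fix i j
  assume "\<And>u. coeff2 F u = coeff2 G u"
  from this[of "(int i, int j)"] show "F $ i $ j = G $ i $ j"
    by (simp add: coeff2_def)
qed

lemma coeff2_diff: "coeff2 (F - G) u = coeff2 F u - coeff2 G u"
  by (simp add: coeff2_def split: prod.splits)

lemma coeff2_mult_mono2:
  "coeff2 (F * mono2 a b) u = coeff2 F (u - (int a, int b))"
proof -
  obtain i j where u: "u = (i, j)" by fastforce
  have nth: "(F * mono2 a b) $ i' $ j' = (if i' < a \<or> j' < b then 0 else F $ (i' - a) $ (j' - b))"
    for i' j'
  proof -
    have "F * mono2 a b = fps_const (fps_X ^ b) * F * fps_X ^ a"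
      by (simp add: mono2_def X_def Y_def fps_const_power mult_ac)
    then have "(F * mono2 a b) $ i' $ j' = (fps_const (fps_X ^ b) * F * fps_X ^ a) $ i' $ j'"
      by (rule arg_cong)
    then show ?thesis
      by (simp add: fps_X_power_mult_nth fps_X_power_mult_right_nth)
  qed
  show ?thesis
    by (auto simp: u coeff2_def nth nat_diff_distrib' nat_less_iff)
qed

text \<open>
  \<open>F'\<close> arises from \<open>F\<close> by a substitution of (Laurent) monomials for \<open>x\<close> and \<open>y\<close>, given by its
  action \<open>\<phi>\<close> on exponent vectors; in particular no negative exponents occur in the result.
\<close>

definition subst_rel :: "(int \<times> int \<Rightarrow> int \<times> int) \<Rightarrow> fps2 \<Rightarrow> fps2 \<Rightarrow> bool" where
  "subst_rel \<phi> F F' \<longleftrightarrow> (\<forall>u. coeff2 F u = coeff2 F' (\<phi> u))"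

lemma subst_rel_right_unique:
  assumes "surj \<phi>" "subst_rel \<phi> F F'" "subst_rel \<phi> F G'"
  shows "F' = G'"
proof (rule coeff2_eqI)
  fix u
  obtain v where "u = \<phi> v" using assms(1) by (meson surjD)
  then show "coeff2 F' u = coeff2 G' u"
    using assms(2,3) unfolding subst_rel_def by metis
qed

lemma subst_rel_left_unique:
  assumes "subst_rel \<phi> F F'" "subst_rel \<phi> G F'"
  shows "F = G"
  using assms unfolding subst_rel_def by (intro coeff2_eqI) metis

lemma subst_rel_1:
  assumes "inj \<phi>" "\<phi> 0 = 0"
  shows "subst_rel \<phi> 1 1"
proof -
  have one: "coeff2 1 u = (if u = 0 then 1 else 0)" for u
    by (cases u) (auto simp: coeff2_def zero_prod_def)
  have "\<phi> u = 0 \<longleftrightarrow> u = 0" for u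
    using assms by (metis injD)
  then show ?thesis by (simp add: subst_rel_def one)
qed

text \<open>As \<phi> is injective, the fibre of the new weights over \<open>\<phi> u\<close> is the
  fibre of the old ones over \<open>u\<close>.\<close>

lemma subst_rel_gen_fun:
  assumes "inj \<phi>"
    and "\<And>l. l \<in> S \<Longrightarrow> \<phi> (int (a l), int (b l)) = (int (a' l), int (b' l))"
  shows "subst_rel \<phi> (gen_fun S a b) (gen_fun S a' b')"
proof -
  have coeff: "coeff2 (gen_fun S c d) u = of_nat (card {l \<in> S. (int (c l), int (d l)) = u})"
    for c d :: "_ \<Rightarrow> nat" and u
  proof (cases u)
    case (Pair i j)
    show ?thesis
    proof (cases "i \<ge> 0 \<and> j \<ge> 0")
      case True
      then have "c l = nat i \<and> d l = nat j \<longleftrightarrow> (int (c l), int (d l)) = u" for l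
        using Pair by auto
      with True Pair show ?thesis by (simp add: coeff2_def gen_fun_def)
    next
      case False
      then have "{l \<in> S. (int (c l), int (d l)) = u} = {}"
        using Pair by auto
      with False Pair show ?thesis by (auto simp: coeff2_def)
    qed
  qed
  have "{l \<in> S. (int (a' l), int (b' l)) = \<phi> u} = {l \<in> S. (int (a l), int (b l)) = u}" for u
    using assms by (auto dest: injD) (metis assms(1,2) injD prod.inject)+
  then show ?thesis
    by (simp add: subst_rel_def coeff)
qed

lemma additive_diagonal:
  assumes "additive \<phi>" "\<phi> (1, 1) = (1, 1)"
  shows "\<phi> (int r, int r) = (int r, int r)"
proof (induction r)
  case 0
  then show ?case using additive.zero[OF assms(1)] by (simp add: zero_prod_def)
next
  case (Suc r)
  then show ?case using additive.add[OF assms(1), of "(int r, int r)" "(1,1)"] assms(2)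
    by (simp add: add.commute)
qed

text \<open>Multiplying by a factor \<open>1 - x^a y^b\<close> subtracts a copy with shifted
  exponents, and an additive \<phi> carries shifts to shifts. Fixing \<open>(1, 1)\<close> means
  fixing the base \<open>xy\<close>.\<close>

lemma subst_rel_mult_qpochhammer:
  assumes "additive \<phi>" "\<phi> (1, 1) = (1, 1)"
    and "\<phi> (int i, int j) = (int i', int j')" "subst_rel \<phi> F F'"
  shows "subst_rel \<phi> (F * qpochhammer (mono2 i j) (mono2 1 1) r)
                       (F' * qpochhammer (mono2 i' j') (mono2 1 1) r)"
proof (induction r)
  case 0
  then show ?case using assms by (simp add: qpochhammer_def)
next
  case (Suc r)
  have "\<phi> (int r, int r) = (int r, int r)"
    by (rule additive_diagonal[OF assms(1,2)])
  then have \<phi>: "\<phi> (u - (int (i + r), int (j + r))) = \<phi> u - (int (i' + r), int (j' + r))" for u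
    using additive.add[OF assms(1), of "(int i, int j)" "(int r, int r)"] assms(3)
      additive.diff[OF assms(1)] by simp
  have factor: "1 - mono2 a b * mono2 1 1 ^ r = 1 - mono2 (a + r) (b + r)" for a b
    by (simp add: mono2_power mono2_mult)
  have step: "G * qpochhammer (mono2 a b) (mono2 1 1) (Suc r) =
      G * qpochhammer (mono2 a b) (mono2 1 1) r
      - G * qpochhammer (mono2 a b) (mono2 1 1) r * mono2 (a + r) (b + r)" for G a b
    by (simp only: qpochhammer_def prod.lessThan_Suc factor right_diff_distrib mult_1_right
      mult.assoc)
  show ?case
    using Suc unfolding step subst_rel_def coeff2_diff coeff2_mult_mono2 \<phi>[symmetric] by metis
qed

section \<open>Generating functions of weighted sets\<close>

lemma gen_fun_cong_bij:
  assumes "bij_betw f S T" "\<And>s. s \<in> S \<Longrightarrow> a s = a' (f s)" "\<And>s. s \<in> S \<Longrightarrow> b s = b' (f s)"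
  shows "gen_fun S a b = gen_fun T a' b'"
proof -
  have "card {s \<in> S. a s = i \<and> b s = j} = card {t \<in> T. a' t = i \<and> b' t = j}" for i j
    using assms by (intro bij_betw_same_card[of f]) (fastforce simp: bij_betw_def inj_on_def)
  then show ?thesis by (simp add: gen_fun_def)
qed

lemma gen_fun_Un:
  assumes "A \<inter> B = {}" "\<And>i j. finite {l \<in> A \<union> B. a l = i \<and> b l = j}"
  shows "gen_fun (A \<union> B) a b = gen_fun A a b + gen_fun B a b"
proof -
  have "card {l \<in> A \<union> B. a l = i \<and> b l = j} =
      card {l \<in> A. a l = i \<and> b l = j} + card {l \<in> B. a l = i \<and> b l = j}" for i j
  proof (subst card_Un_disjoint[symmetric])
    show "finite {l \<in> A. a l = i \<and> b l = j}" "finite {l \<in> B. a l = i \<and> b l = j}"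
      by (rule finite_subset[OF _ assms(2)[of i j]], blast)+
  qed (use assms(1) in \<open>auto intro: arg_cong[of _ _ card]\<close>)
  then show ?thesis by (auto simp: gen_fun_def fps_eq_iff)
qed

lemma gen_fun_Suc: "gen_fun S (\<lambda>l. Suc (a l)) b = X * gen_fun S a b"
  by (auto simp: gen_fun_def X_def fps_eq_iff gr0_conv_Suc)

text \<open>Splitting off \<open>s = 0\<close> gives \<open>G = gen_fun S a b + X * G\<close>: the
  free \<open>s\<close> contributes a geometric series.\<close>

lemma gen_fun_UNIV_Times:
  fixes a b :: "'a \<Rightarrow> nat"
  assumes "\<And>i j. finite {l \<in> S. a l = i \<and> b l = j}"
  shows "(1 - X) * gen_fun (UNIV \<times> S) (\<lambda>(s, l). s + a l) (\<lambda>(s, l). b l) = gen_fun S a b"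
proof -
  let ?a = "\<lambda>(s, l). s + a l" and ?b = "\<lambda>(s :: nat, l). b l"
  have fin: "finite {p \<in> UNIV \<times> S. ?a p = i \<and> ?b p = j}" for i j
    by (rule finite_subset[of _ "{..i} \<times> (\<Union>i'\<le>i. {l \<in> S. a l = i' \<and> b l = j})"])
      (use assms in auto)
  have split: "UNIV \<times> S = {0::nat} \<times> S \<union> {1..} \<times> S"
    by (auto simp: not_less_eq_eq)
  have "gen_fun (UNIV \<times> S) ?a ?b = gen_fun ({0} \<times> S) ?a ?b + gen_fun ({1..} \<times> S) ?a ?b"
    unfolding split by (rule gen_fun_Un) (use fin split in auto)
  also have "gen_fun ({0} \<times> S) ?a ?b = gen_fun S a b"
    by (rule gen_fun_cong_bij[of snd]) (auto simp: bij_betw_def inj_on_def image_iff)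
  also have "gen_fun ({1..} \<times> S) ?a ?b = gen_fun (UNIV \<times> S) (\<lambda>p. Suc (?a p)) ?b"
    by (rule sym, rule gen_fun_cong_bij[of "map_prod Suc id"])
      (auto simp: bij_betw_def inj_on_def image_iff Bex_def not_less_eq_eq dest: Suc_le_D)
  finally have "gen_fun (UNIV \<times> S) ?a ?b = gen_fun S a b + X * gen_fun (UNIV \<times> S) ?a ?b"
    unfolding gen_fun_Suc .
  then show ?thesis
    unfolding left_diff_distrib mult_1_left by (metis add_diff_cancel_right')
qed

section \<open>The reflection\<close>

text \<open>
  Here \<open>m\<close> is the denominator of the first part, so that \<open>m = n - k + 1\<close>. Multiplied out, the
  inequalities are also correct for \<open>m = 0\<close>.
\<close>

fun anti_lh :: "nat \<Rightarrow> nat list \<Rightarrow> bool" where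
  "anti_lh m (a # b # l) \<longleftrightarrow> m * b \<le> (m + 1) * a \<and> anti_lh (m + 1) (b # l)"
| "anti_lh m _ \<longleftrightarrow> True"

definition AL :: "nat \<Rightarrow> nat \<Rightarrow> nat list set" where
  "AL m k = {l. length l = k \<and> anti_lh m l}"

abbreviation osum :: "nat list \<Rightarrow> nat" where "osum l \<equiv> sum_list (odd_parts l)"
abbreviation esum :: "nat list \<Rightarrow> nat" where "esum l \<equiv> sum_list (even_parts l)"

lemma parts_simps [simp]:
  "odd_parts [] = []" "even_parts [] = []"
  "odd_parts (a # l) = a # even_parts l" "even_parts (a # l) = odd_parts l"
  by (simp_all add: odd_parts_def even_parts_def nths_Cons)

lemma osum_snoc: "osum (l @ [z]) = (if even (length l) then osum l + z else osum l)"
  and esum_snoc: "esum (l @ [z]) = (if even (length l) then esum l else esum l + z)"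
  by (induction l) auto

section \<open>The inequalities cleared of denominators\<close>

lemma anti_lh_nth:
  "anti_lh m l \<longleftrightarrow> (\<forall>j\<in>{1..<length l}. (m + j - 1) * l ! j \<le> (m + j) * l ! (j - 1))"
proof (induction m l rule: anti_lh.induct)
  case (1 m a b l)
  let ?P = "\<lambda>j. (m + j - 1) * (a # b # l) ! j \<le> (m + j) * (a # b # l) ! (j - 1)"
  have eq: "{1..<length (a # b # l)} = insert 1 (Suc ` {1..<length (b # l)})"
    by (auto simp: image_iff Bex_def)
  have shift: "(m + Suc j - 1) * (a # b # l) ! Suc j \<le> (m + Suc j) * (a # b # l) ! (Suc j - 1) \<longleftrightarrow>
      (m + 1 + j - 1) * (b # l) ! j \<le> (m + 1 + j) * (b # l) ! (j - 1)" if "j \<ge> 1" for j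
    using that by (cases j) auto
  have "(\<forall>j\<in>{1..<length (a # b # l)}. ?P j) \<longleftrightarrow>
      ?P 1 \<and> (\<forall>j\<in>{1..<length (b # l)}. ?P (Suc j))"
    unfolding eq by blast
  also have "(\<forall>j\<in>{1..<length (b # l)}. ?P (Suc j)) \<longleftrightarrow> anti_lh (m + 1) (b # l)"
    unfolding 1 by (intro ball_cong refl shift) simp
  finally show ?case by simp
qed auto

lemma truncated_anti_lecture_hall_eq_AL:
  assumes "k \<le> n + 1"
  shows "truncated_anti_lecture_hall n k = AL (n + 1 - k) k"
proof -
  define m where "m = n + 1 - k"
  have n: "n = m + k - 1" "n + 1 = m + k" using assms by (auto simp: m_def)
  have "(n + j = k \<or>
           of_nat q / al_denom n k (j + 1) \<le> (of_nat p / al_denom n k j :: rat)) \<longleftrightarrow>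
        (m + j - 1) * q \<le> (m + j) * p" if "j \<ge> 1" for j p q
  proof -
    have d: "al_denom n k j = of_nat (m + j - 1)" "al_denom n k (j + 1) = of_nat (m + j)"
    proof -
      have "(of_nat (n + 1) :: rat) = of_nat (m + k)" using n by simp
      then have "(of_nat n :: rat) = of_nat m + of_nat k - 1" by simp
      then show "al_denom n k j = of_nat (m + j - 1)" "al_denom n k (j + 1) = of_nat (m + j)"
        using that by (auto simp: al_denom_def of_nat_diff)
    qed
    show ?thesis
    proof (cases "m + j = 1")
      \<comment> \<open>This forces \<open>m = 0\<close> and \<open>j = 1\<close>: the denominator
        vanishes, and the multiplied-out inequality \<open>0 \<le> p\<close> is void as
        well.\<close>
      case True
      then show ?thesis using n(2) by auto
    next
      case False
      then have pos: "m + j - 1 > 0" "m + j > 0" and "n + j \<noteq> k" using that n(2) by auto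
      then have "of_nat q / al_denom n k (j + 1) \<le> (of_nat p / al_denom n k j :: rat) \<longleftrightarrow>
          (of_nat q * of_nat (m + j - 1) :: rat) \<le> of_nat p * of_nat (m + j)"
        unfolding d by (simp add: field_simps del: of_nat_diff of_nat_add)
      also have "\<dots> \<longleftrightarrow> q * (m + j - 1) \<le> p * (m + j)"
        unfolding of_nat_mult[symmetric] of_nat_le_iff ..
      finally show ?thesis using \<open>n + j \<noteq> k\<close> by (simp add: mult.commute)
    qed
  qed
  then show ?thesis
    unfolding truncated_anti_lecture_hall_def AL_def anti_lh_nth m_def[symmetric] by auto
qed

section \<open>Bounds imposed by a neighbour\<close>

definition hi :: "nat \<Rightarrow> nat \<Rightarrow> nat" where "hi m b = b + b div m"
text \<open>For \<open>b\<close> with denominator \<open>m > 0\<close>, \<open>hi m b\<close> is the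
  floor of \<open>(m+1)b/m\<close>, the largest entry allowed after \<open>b\<close>, and
  \<open>lo m b\<close> is the ceiling of \<open>(m-1)b/m\<close>, the smallest allowed before
  it.\<close>

definition lo :: "nat \<Rightarrow> nat \<Rightarrow> nat" where "lo m b = b - b div m"

text \<open>The two floors cancel; hence sums of bounds telescope when an entry bounds both of its
  neighbours.\<close>

lemma lo_plus_hi: "lo m b + hi m b = 2 * b"
  by (simp add: lo_def hi_def)

lemma le_hi_iff: "m > 0 \<Longrightarrow> c \<le> hi m b \<longleftrightarrow> m * c \<le> (m + 1) * b"
proof -
  assume "m > 0"
  then have "m * c \<le> (m + 1) * b \<longleftrightarrow> c \<le> ((m + 1) * b) div m"
    using less_eq_div_iff_mult_less_eq[of m c "(m + 1) * b"] by (simp add: mult.commute)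
  also have "((m + 1) * b) div m = hi m b"
    using \<open>m > 0\<close> by (simp add: hi_def algebra_simps)
  finally show ?thesis by simp
qed

text \<open>With \<open>b = (m+1)t + r\<close> and \<open>r \<le> m\<close>, one has
  \<open>(m+1) * lo (m+1) b = m * b + r\<close>, so \<open>lo (m+1) b\<close> is
  \<open>mb/(m+1)\<close> rounded up.\<close>

lemma lo_le_iff: "lo (m + 1) b \<le> a \<longleftrightarrow> m * b \<le> (m + 1) * a"
proof -
  define t r where "t = b div (m + 1)" and "r = b mod (m + 1)"
  have b: "b = (m + 1) * t + r"
    unfolding t_def r_def by (simp only: mult_div_mod_eq)
  have "r < m + 1" by (simp add: r_def)
  then have r: "r \<le> m" by simp
  have lo: "lo (m + 1) b = m * t + r"
    unfolding lo_def t_def[symmetric] by (subst b) simp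
  show ?thesis
  proof
    assume "lo (m + 1) b \<le> a"
    then have "(m + 1) * (m * t + r) \<le> (m + 1) * a" unfolding lo by (rule mult_le_mono2)
    then show "m * b \<le> (m + 1) * a" unfolding b by (simp add: algebra_simps)
  next
    assume *: "m * b \<le> (m + 1) * a"
    show "lo (m + 1) b \<le> a"
    proof (rule ccontr)
      assume "\<not> lo (m + 1) b \<le> a"
      then have "a + 1 \<le> m * t + r" using lo by simp
      then have "(m + 1) * (a + 1) \<le> (m + 1) * (m * t + r)" by (rule mult_le_mono2)
      then show False using * r unfolding b by (simp add: algebra_simps)
    qed
  qed
qed

lemma anti_lh_Cons2: "anti_lh m (a # b # l) \<longleftrightarrow> lo (m + 1) b \<le> a \<and> anti_lh (m + 1) (b # l)"
  unfolding lo_le_iff by simp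

lemma anti_lh_Cons2_hi:
  "m > 0 \<Longrightarrow> anti_lh m (a # b # l) \<longleftrightarrow> b \<le> hi m a \<and> anti_lh (m + 1) (b # l)"
  by (simp add: le_hi_iff)

lemma anti_lh_Cons3:
  assumes "m > 0"
  shows "anti_lh m (b # c # d # l) \<longleftrightarrow>
     c \<le> hi m b \<and> lo (m + 2) d \<le> c \<and> anti_lh (m + 2) (d # l)"
proof -
  have "m + 1 + 1 = m + 2" by simp
  then show ?thesis
    using anti_lh_Cons2_hi[OF assms, of b c "d # l"] anti_lh_Cons2[of "m + 1" c d l] by metis
qed

lemma anti_lh_snoc:
  assumes "m > 0" "l \<noteq> []"
  shows "anti_lh m (l @ [z]) \<longleftrightarrow> anti_lh m l \<and> z \<le> hi (m + length l - 1) (last l)"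
  using assms
proof (induction m l rule: anti_lh.induct)
  case (1 m a b l)
  then show ?case by simp
qed (simp_all add: le_hi_iff)

text \<open>Each pair of consecutive entries \<open>a\<close>, \<open>b\<close> satisfies
  \<open>b \<le> hi m a \<le> 2a\<close>. This keeps \<open>2 * osum l - esum l\<close> from
  truncating and bounds all lists with a given \<open>osum\<close>.\<close>

lemma esum_le_osum: "m > 0 \<Longrightarrow> anti_lh m l \<Longrightarrow> esum l \<le> 2 * osum l"
proof (induction l arbitrary: m rule: induct_list012)
  case (3 a b l)
  then have "b \<le> hi m a" and tl: "anti_lh (m + 1) (b # l)"
    using anti_lh_Cons2_hi[of m a b l] by auto
  then have "b \<le> 2 * a" using div_le_dividend[of a m] unfolding hi_def by linarith
  moreover have "anti_lh (m + 2) l" using tl by (cases l) auto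
  then have "esum l \<le> 2 * osum l" using 3 by (meson add_gr_0)
  ultimately show ?case by simp
qed auto

text \<open>
  In \<open>b # l\<close>, where \<open>b\<close> has denominator \<open>m\<close>, the first, third, ... entries of \<open>l\<close> are reflected in
  the intervals to which they are confined by their neighbours.
\<close>

fun reflect :: "nat \<Rightarrow> nat \<Rightarrow> nat list \<Rightarrow> nat list" where
  "reflect m b [] = []"
| "reflect m b [c] = [hi m b - c]"
| "reflect m b (c # d # l) = (hi m b + lo (m + 2) d - c) # d # reflect (m + 2) d l"

lemma length_reflect [simp]: "length (reflect m b l) = length l"
  by (induction m b l rule: reflect.induct) auto

lemma esum_reflect: "esum (reflect m b l) = esum l"
  by (induction m b l rule: reflect.induct) auto

text \<open>The endpoints of each interval depend only on entries that \<open>reflect\<close> leaves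
  fixed, so reflected entries stay in their intervals. For the same reason \<open>reflect\<close> is
  an involution.\<close>

lemma anti_lh_reflect:
  "m > 0 \<Longrightarrow> anti_lh m (b # l) \<Longrightarrow> anti_lh m (b # reflect m b l)"
proof (induction m b l rule: reflect.induct)
  case (3 m b c d l)
  then show ?case unfolding reflect.simps by (auto simp: anti_lh_Cons3 simp del: anti_lh.simps)
qed (auto simp: anti_lh_Cons2_hi simp del: anti_lh.simps(1))

lemma reflect_reflect:
  "m > 0 \<Longrightarrow> anti_lh m (b # l) \<Longrightarrow> reflect m b (reflect m b l) = l"
proof (induction m b l rule: reflect.induct)
  case (3 m b c d l)
  then show ?case by (auto simp: anti_lh_Cons3 simp del: anti_lh.simps)
qed (auto simp: anti_lh_Cons2_hi simp del: anti_lh.simps(1))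

text \<open>An entry and its reflection add up to the sum of the endpoints of their interval. Each
  fixed entry \<open>d\<close> of \<open>l\<close> contributes \<open>lo + hi = 2d\<close>; the last
  interval starts at \<open>0\<close>, so only \<open>hi m b\<close> is left over.\<close>

lemma osum_reflect_odd:
  "m > 0 \<Longrightarrow> anti_lh m (b # l) \<Longrightarrow> odd (length l) \<Longrightarrow>
     osum l + osum (reflect m b l) = hi m b + 2 * esum l"
proof (induction m b l rule: reflect.induct)
  case (3 m b c d l)
  then show ?case using lo_plus_hi[of "m + 2" d]
    by (auto simp: anti_lh_Cons3 simp del: anti_lh.simps)
qed (auto simp: anti_lh_Cons2_hi simp del: anti_lh.simps(1))

text \<open>Here the last entry of \<open>b # l\<close> is fixed and bounds nothing to its right, so
  its \<open>hi\<close> is missing from the telescoped sum.\<close>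

lemma osum_reflect_even:
  "m > 0 \<Longrightarrow> anti_lh m (b # l) \<Longrightarrow> even (length l) \<Longrightarrow>
     osum l + osum (reflect m b l) + hi (m + length l) (last (b # l)) = hi m b + 2 * esum l"
proof (induction m b l rule: reflect.induct)
  case (3 m b c d l)
  then have "osum l + osum (reflect (m + 2) d l) + hi (m + 2 + length l) (last (d # l)) =
      hi (m + 2) d + 2 * esum l"
    by (auto simp: anti_lh_Cons3 simp del: anti_lh.simps)
  then show ?case using 3 lo_plus_hi[of "m + 2" d]
    by (auto simp: anti_lh_Cons3 add_ac simp del: anti_lh.simps)
qed auto

section \<open>The bijection that removes the first entry\<close>

fun extend :: "nat \<Rightarrow> nat \<times> nat list \<Rightarrow> nat list" where
  "extend m (s, []) = [s]"
| "extend m (s, b # l) = (lo (m + 1) b + s) # b # reflect (m + 1) b l"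

fun restrict :: "nat \<Rightarrow> nat list \<Rightarrow> nat \<times> nat list" where
  "restrict m (a # b # l) = (a - lo (m + 1) b, b # reflect (m + 1) b l)"
| "restrict m [a] = (a, [])"
| "restrict m [] = (0, [])"

text \<open>The number \<open>s\<close> is the excess of the first entry over
  \<open>lo (m+1) b\<close>, or over \<open>0\<close> if nothing follows. \<open>restrict\<close>
  inverts \<open>extend\<close> because \<open>reflect\<close> is an involution.\<close>

lemma bij_extend: "bij_betw (extend m) (UNIV \<times> AL (m + 1) k) (AL m (k + 1))"
proof (rule bij_betw_byWitness[where f' = "restrict m"])
  show "\<forall>p\<in>UNIV \<times> AL (m + 1) k. restrict m (extend m p) = p"
  proof safe
    fix s l assume "l \<in> AL (m + 1) k"
    then show "restrict m (extend m (s, l)) = (s, l)"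
      using reflect_reflect[of "m + 1"] by (cases l) (auto simp: AL_def)
  qed
  show "\<forall>l\<in>AL m (k + 1). extend m (restrict m l) = l"
  proof
    fix l assume l: "l \<in> AL m (k + 1)"
    show "extend m (restrict m l) = l"
    proof (cases "(m, l)" rule: restrict.cases)
      case (1 m' a b t)
      with l have "lo (m + 1) b \<le> a" "anti_lh (m + 1) (b # t)"
        using anti_lh_Cons2[of m a b t] by (auto simp: AL_def)
      with 1 show ?thesis using reflect_reflect[of "m + 1" b t] by simp
    qed (use l in \<open>auto simp: AL_def\<close>)
  qed
  show "extend m ` (UNIV \<times> AL (m + 1) k) \<subseteq> AL m (k + 1)"
  proof safe
    fix s l assume l: "l \<in> AL (m + 1) k"
    show "extend m (s, l) \<in> AL m (k + 1)"
    proof (cases l)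
      case (Cons b t)
      with l have "anti_lh m ((lo (m + 1) b + s) # b # reflect (m + 1) b t)"
        unfolding anti_lh_Cons2 using anti_lh_reflect[of "m + 1" b t] by (auto simp: AL_def)
      with l Cons show ?thesis by (simp add: AL_def del: anti_lh.simps)
    qed (use l in \<open>auto simp: AL_def\<close>)
  qed
  show "restrict m ` AL m (k + 1) \<subseteq> UNIV \<times> AL (m + 1) k"
  proof safe
    fix s t l assume l: "l \<in> AL m (k + 1)" and eq: "(s, t) = restrict m l"
    show "t \<in> AL (m + 1) k"
    proof (cases "(m, l)" rule: restrict.cases)
      case (1 m' a b u)
      with l have "anti_lh (m + 1) (b # u)"
        using anti_lh_Cons2[of m a b u] by (auto simp: AL_def)
      with 1 show ?thesis using anti_lh_reflect[of "m + 1" b u] eq l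
        by (simp add: AL_def del: anti_lh.simps)
    qed (use l eq in \<open>auto simp: AL_def\<close>)
  qed simp
qed

lemma esum_extend: "esum (extend m (s, l)) = osum l"
  by (cases l) (auto simp: esum_reflect)

text \<open>Together with \<open>esum_extend\<close> this turns the weight of the extended list into
  \<open>x^s (x^2 y)^(osum l) (1/x)^(esum l)\<close>, which is the substitution.\<close>

lemma osum_extend_even:
  assumes "anti_lh (m + 1) l" "even (length l)"
  shows "osum (extend m (s, l)) = s + (2 * osum l - esum l)"
proof (cases l)
  case (Cons b t)
  then show ?thesis
    using assms osum_reflect_odd[of "m + 1" b t] lo_plus_hi[of "m + 1" b] by simp
qed simp

lemma osum_extend_odd:
  assumes "anti_lh (m + 1) l" "odd (length l)"
  shows "osum (extend m (s, l)) + hi (m + length l) (last l) + esum l = s + 2 * osum l"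
proof (cases l)
  case (Cons b t)
  then show ?thesis
    using assms osum_reflect_even[of "m + 1" b t] lo_plus_hi[of "m + 1" b] by simp
qed (use assms in simp)

section \<open>Recurrences for the generating function\<close>

abbreviation AL_gf :: "nat \<Rightarrow> nat \<Rightarrow> fps2" where
  "AL_gf m k \<equiv> gen_fun (AL m k) osum esum"

text \<open>The series obtained by the substitution of \<open>x\<^sup>2y\<close> for \<open>x\<close> and \<open>1/x\<close> for \<open>y\<close>.\<close>

abbreviation AL_gf' :: "nat \<Rightarrow> nat \<Rightarrow> fps2" where
  "AL_gf' m k \<equiv> gen_fun (AL m k) (\<lambda>l. 2 * osum l - esum l) osum"

lemma finite_bounded_sum: "finite {l :: nat list. length l = k \<and> osum l + esum l \<le> N}"
proof (rule finite_subset)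
  show "{l :: nat list. length l = k \<and> osum l + esum l \<le> N}
          \<subseteq> {l. set l \<subseteq> {..N} \<and> length l = k}"
    unfolding sum_list_odd_even_parts by (auto dest: member_le_sum_list)
  show "finite {l. set l \<subseteq> {..N} \<and> length l = k}"
    by (rule finite_lists_length_eq) simp
qed

lemma finite_AL_level: "finite {l \<in> AL m k. osum l = i \<and> esum l = j}"
  by (rule finite_subset[OF _ finite_bounded_sum[of k "i + j"]]) (auto simp: AL_def)

lemma finite_AL_level':
  assumes "m > 0"
  shows "finite {l \<in> AL m k. 2 * osum l - esum l = i \<and> osum l = j}"
proof (rule finite_subset[OF _ finite_bounded_sum[of k "3 * j"]], safe)
  fix l assume "l \<in> AL m k"
  with esum_le_osum[OF assms, of l] show "length l = k" "osum l + esum l \<le> 3 * osum l"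
    by (auto simp: AL_def)
qed

lemma AL_gf_odd:
  assumes "even k"
  shows "(1 - X) * AL_gf m (k + 1) = AL_gf' (m + 1) k"
proof -
  have "AL_gf m (k + 1) = gen_fun (UNIV \<times> AL (m + 1) k)
      (\<lambda>(s, l). s + (2 * osum l - esum l)) (\<lambda>(s, l). osum l)"
    using assms
    by (intro gen_fun_cong_bij[OF bij_extend, symmetric])
      (auto simp: AL_def osum_extend_even esum_extend)
  then show ?thesis
    using gen_fun_UNIV_Times[of "AL (m + 1) k" "\<lambda>l. 2 * osum l - esum l" osum]
      finite_AL_level' by simp
qed

text \<open>Let \<open>h l\<close> be the largest value that can be appended to \<open>l\<close>. A
  pair with \<open>s \<le> h l\<close> becomes a list longer by one; a pair with
  \<open>s > h l\<close> keeps the free excess \<open>s - h l - 1\<close>. These cases give the two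
  terms.\<close>

lemma AL_gf_even:
  assumes "odd k"
  shows "(1 - X) * AL_gf m (k + 1) = (1 - X) * AL_gf' (m + 1) (k + 1) + X * AL_gf' (m + 1) k"
proof -
  define h where "h l = hi (m + k) (last l)" for l
  define S where "S = (UNIV :: nat set) \<times> AL (m + 1) k"
  define S1 where "S1 = {(s, l). l \<in> AL (m + 1) k \<and> s \<le> h l}"
  define S2 where "S2 = {(s, l). l \<in> AL (m + 1) k \<and> s > h l}"
  let ?a = "\<lambda>p. osum (extend m p)" and ?b = "\<lambda>p. esum (extend m p)"
  have S: "S = S1 \<union> S2" by (auto simp: S_def S1_def S2_def)
  have a: "?a (s, l) + h l + esum l = s + 2 * osum l"
    and e: "esum l \<le> 2 * osum l" and len: "length l = k"
    if "l \<in> AL (m + 1) k" for s l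
  proof -
    show "length l = k" using that by (simp add: AL_def)
    then show "?a (s, l) + h l + esum l = s + 2 * osum l" "esum l \<le> 2 * osum l"
      using osum_extend_odd[of m l s] esum_le_osum[of "m + 1" l] assms that
      by (auto simp: h_def AL_def)
  qed
  have fin: "finite {p \<in> S. ?a p = i \<and> ?b p = j}" for i j
  proof -
    have "inj_on (extend m) {p \<in> S. ?a p = i \<and> ?b p = j}"
      using bij_extend[of m k] by (auto simp: bij_betw_def S_def intro: inj_on_subset)
    moreover have "extend m ` {p \<in> S. ?a p = i \<and> ?b p = j}
        \<subseteq> {l \<in> AL m (k + 1). osum l = i \<and> esum l = j}"
      using bij_extend[of m k] by (auto simp: bij_betw_def S_def)
    then have "finite (extend m ` {p \<in> S. ?a p = i \<and> ?b p = j})"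
      using finite_AL_level by (rule finite_subset)
    ultimately show ?thesis
      by (rule finite_imageD[rotated])
  qed
  have "AL_gf m (k + 1) = gen_fun S ?a ?b"
    unfolding S_def by (intro gen_fun_cong_bij[OF bij_extend, symmetric]) auto
  also have "\<dots> = gen_fun S1 ?a ?b + gen_fun S2 ?a ?b"
    unfolding S by (rule gen_fun_Un) (use fin in \<open>auto simp: S S1_def S2_def\<close>)
  also have "gen_fun S1 ?a ?b = AL_gf' (m + 1) (k + 1)"
  \<comment> \<open>As \<open>length l\<close> is odd, the appended entry has even index and
    contributes \<open>s - h l\<close> to \<open>2 * osum - esum\<close>, as
    \<open>osum_extend_odd\<close> requires.\<close>
  proof (rule gen_fun_cong_bij[of "\<lambda>(s, l). l @ [h l - s]"])
    show "bij_betw (\<lambda>(s, l). l @ [h l - s]) S1 (AL (m + 1) (k + 1))"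
    proof (rule bij_betw_byWitness[where f' = "\<lambda>l. (h (butlast l) - last l, butlast l)"])
      have *: "l \<in> AL (m + 1) (k + 1) \<longleftrightarrow> (\<exists>u z. l = u @ [z] \<and> u \<in> AL (m + 1) k \<and> z \<le> h u)" for l
      proof -
        have "anti_lh (m + 1) (u @ [z]) \<longleftrightarrow> anti_lh (m + 1) u \<and> z \<le> h u"
          if "length u = k" for u z
        proof -
          have "u \<noteq> []" using that assms by auto
          then show ?thesis using anti_lh_snoc[of "m + 1" u z] that by (simp add: h_def)
        qed
        then show ?thesis
          by (cases l rule: rev_cases) (auto simp: AL_def)
      qed
      show "\<forall>l\<in>AL (m + 1) (k + 1).
          (case (h (butlast l) - last l, butlast l) of (s, l) \<Rightarrow> l @ [h l - s]) = l"
        unfolding Ball_def * by auto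
      show "(\<lambda>(s, l). l @ [h l - s]) ` S1 \<subseteq> AL (m + 1) (k + 1)"
        "(\<lambda>l. (h (butlast l) - last l, butlast l)) ` AL (m + 1) (k + 1) \<subseteq> S1"
        unfolding image_subset_iff Ball_def * by (auto simp: S1_def)
    qed (auto simp: S1_def)
  next
    fix p assume "p \<in> S1"
    then obtain s l where p: "p = (s, l)" "l \<in> AL (m + 1) k" "s \<le> h l"
      by (auto simp: S1_def)
    with a[of l s] len[of l] assms
    show "?a p = 2 * osum (case p of (s, l) \<Rightarrow> l @ [h l - s])
        - esum (case p of (s, l) \<Rightarrow> l @ [h l - s])"
      "?b p = osum (case p of (s, l) \<Rightarrow> l @ [h l - s])"
      by (auto simp: osum_snoc esum_snoc esum_extend)
  qed
  also have "gen_fun S2 ?a ?b = gen_fun (UNIV \<times> AL (m + 1) k)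
      (\<lambda>p. Suc (case p of (s, l) \<Rightarrow> s + (2 * osum l - esum l))) (\<lambda>(s, l). osum l)"
  proof (rule gen_fun_cong_bij[of "\<lambda>(s, l). (s - Suc (h l), l)"])
    show "bij_betw (\<lambda>(s, l). (s - Suc (h l), l)) S2 (UNIV \<times> AL (m + 1) k)"
      by (rule bij_betw_byWitness[where f' = "\<lambda>(s, l). (s + Suc (h l), l)"])
        (auto simp: S2_def)
  next
    fix p assume "p \<in> S2"
    then obtain s l where p: "p = (s, l)" "l \<in> AL (m + 1) k" "s > h l"
      by (auto simp: S2_def)
    with a[of l s] e[of l]
    show "?a p = Suc (case (case p of (s, l) \<Rightarrow> (s - Suc (h l), l)) of
        (s, l) \<Rightarrow> s + (2 * osum l - esum l))"
      "?b p = (case (case p of (s, l) \<Rightarrow> (s - Suc (h l), l)) of (s, l) \<Rightarrow> osum l)"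
      by (auto simp: esum_extend)
  qed
  finally have "AL_gf m (k + 1) = AL_gf' (m + 1) (k + 1) + X * gen_fun (UNIV \<times> AL (m + 1) k)
      (\<lambda>(s, l). s + (2 * osum l - esum l)) (\<lambda>(s, l). osum l)"
    unfolding gen_fun_Suc .
  moreover have "(1 - X) * gen_fun (UNIV \<times> AL (m + 1) k)
      (\<lambda>(s, l). s + (2 * osum l - esum l)) (\<lambda>(s, l). osum l) = AL_gf' (m + 1) k"
    by (rule gen_fun_UNIV_Times) (simp add: finite_AL_level')
  ultimately show ?thesis
    by (simp only: distrib_left mult.left_commute)
qed

text \<open>For \<open>m = 0\<close> the first entry is unconstrained, and removing it exchanges odd
  and even positions.\<close>

lemma AL_gf_0: "(1 - X) * AL_gf 0 (k + 1) = gen_fun (AL 1 k) esum osum"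
proof -
  have *: "anti_lh 0 (a # l) \<longleftrightarrow> anti_lh 1 l" for a l
    by (cases l) auto
  have "AL_gf 0 (k + 1) = gen_fun (UNIV \<times> AL 1 k) (\<lambda>(s, l). s + esum l) (\<lambda>(s, l). osum l)"
  proof (rule gen_fun_cong_bij[symmetric])
    show "bij_betw (\<lambda>(s, l). s # l) (UNIV \<times> AL 1 k) (AL 0 (k + 1))"
      by (rule bij_betw_byWitness[where f' = "\<lambda>l. (hd l, tl l)"])
        (auto simp: AL_def length_Suc_conv *)
  qed auto
  moreover have "finite {l \<in> AL 1 k. esum l = i \<and> osum l = j}" for i j
    by (rule finite_subset[OF _ finite_AL_level[of 1 k j i]]) auto
  ultimately show ?thesis
    using gen_fun_UNIV_Times[of "AL 1 k" esum osum] by simp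
qed

section \<open>The product formula\<close>

text \<open>
  Cleared of denominators, the formula at \<open>n = m + k - 1\<close> with \<open>x\<^sup>iy\<^sup>j\<close> for \<open>x\<close> and
  \<open>x\<^bsup>i'\<^esup>y\<^bsup>j'\<^esup>\<close> for \<open>x\<^sup>my\<^bsup>m+1\<^esup>\<close>.
\<close>

definition product_formula :: "nat \<Rightarrow> nat \<Rightarrow> nat \<Rightarrow> nat \<Rightarrow> nat \<Rightarrow> nat \<Rightarrow> fps2 \<Rightarrow> bool" where
  "product_formula m k i j i' j' F \<longleftrightarrow>
     F * qpochhammer (mono2 i j) (mono2 1 1) ((k + 1) div 2)
       * qpochhammer (mono2 i' j') (mono2 1 1) (k div 2)
       * qpochhammer (mono2 1 1) (mono2 1 1) (k div 2)
     = qpochhammer (mono2 1 1 ^ (m + (k + 1) div 2)) (mono2 1 1) (k div 2)"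

text \<open>The right-hand side involves only powers of \<open>xy\<close>, which \<phi> fixes. Right
  uniqueness of \<open>subst_rel\<close> then gives one direction and left uniqueness the
  other.\<close>

lemma product_formula_subst:
  assumes \<phi>: "additive \<phi>" "bij \<phi>" "\<phi> (1, 1) = (1, 1)"
    and ij: "\<phi> (int i, int j) = (int p, int q)" "\<phi> (int i', int j') = (int p', int q')"
    and F: "subst_rel \<phi> F F'"
  shows "product_formula m k i j i' j' F \<longleftrightarrow> product_formula m k p q p' q' F'"
proof -
  have one: "\<phi> (int 1, int 1) = (int 1, int 1)"
    using \<phi>(3) by simp
  have sr1: "subst_rel \<phi> 1 1"
    using \<phi> by (intro subst_rel_1) (auto simp: bij_is_inj additive.zero)
  have "subst_rel \<phi> (1 * qpochhammer (mono2 r r) (mono2 1 1) s)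
                   (1 * qpochhammer (mono2 r r) (mono2 1 1) s)" for r s
    by (intro subst_rel_mult_qpochhammer \<phi> additive_diagonal sr1)
  then have rhs: "subst_rel \<phi> (qpochhammer (mono2 1 1 ^ r) (mono2 1 1) s)
                      (qpochhammer (mono2 1 1 ^ r) (mono2 1 1) s)" for r s
    by (simp add: mono2_power)
  have lhs: "subst_rel \<phi>
      (F * qpochhammer (mono2 i j) (mono2 1 1) s * qpochhammer (mono2 i' j') (mono2 1 1) t
         * qpochhammer (mono2 1 1) (mono2 1 1) t)
      (F' * qpochhammer (mono2 p q) (mono2 1 1) s * qpochhammer (mono2 p' q') (mono2 1 1) t
         * qpochhammer (mono2 1 1) (mono2 1 1) t)" for s t
    by (intro subst_rel_mult_qpochhammer \<phi> ij one F)
  show ?thesis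
    unfolding product_formula_def
    by (metis (no_types, lifting) subst_rel_right_unique[OF bij_is_surj[OF \<phi>(2)]]
      subst_rel_left_unique lhs rhs)
qed

text \<open>The substitution turns \<open>x^m y^(m+1)\<close> into \<open>x^(m-1) y^m\<close>, the
  monomial belonging to \<open>m - 1\<close>; \<open>m > 0\<close> keeps its exponents
  nonnegative.\<close>

lemma product_formula_AL_gf':
  assumes "m > 0"
  shows "product_formula m k 1 0 m (m + 1) (AL_gf m k) \<longleftrightarrow>
         product_formula m k 2 1 (m - 1) m (AL_gf' m k)"
proof -
  define \<phi> :: "int \<times> int \<Rightarrow> int \<times> int" where "\<phi> = (\<lambda>(a, b). (2 * a - b, a))"
  have "bij \<phi>"
    by (rule bij_betw_byWitness[where f' = "\<lambda>(a, b). (b, 2 * b - a)"]) (auto simp: \<phi>_def)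
  then show ?thesis
    using assms esum_le_osum[of m]
    by (intro product_formula_subst[of \<phi>] subst_rel_gen_fun)
      (auto simp: additive_def \<phi>_def bij_is_inj AL_def of_nat_diff split: prod.splits)
qed

lemma product_formula_swap:
  "product_formula m k 1 0 m (m + 1) (AL_gf m k) \<longleftrightarrow>
   product_formula m k 0 1 (m + 1) m (gen_fun (AL m k) esum osum)"
proof -
  have "bij (prod.swap :: int \<times> int \<Rightarrow> _)" by simp
  then show ?thesis
    by (intro product_formula_subst[of prod.swap] subst_rel_gen_fun)
      (auto simp: additive_def)
qed

section \<open>The recurrences on the product side\<close>

lemma qpochhammer_Suc: "qpochhammer a q (Suc m) = qpochhammer a q m * (1 - a * q ^ m)"
  by (simp add: qpochhammer_def)

lemma qpochhammer_Suc_shift: "qpochhammer a q (Suc m) = (1 - a) * qpochhammer (a * q) q m"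
  unfolding qpochhammer_def by (subst prod.lessThan_Suc_shift) (simp add: mult_ac)

lemma one_minus_X_neq_0: "1 - X \<noteq> 0"
proof
  assume "1 - X = 0"
  then have "(1 - X) $ 0 = 0" by simp
  then show False by (simp add: X_def)
qed

lemma X_eq_mono2: "X = mono2 1 0"
  by (simp add: mono2_def)

text \<open>With \<open>q = xy\<close>, the identity
  \<open>(x; q)_(j+1) = (1 - x) (x^2 y; q)_j\<close> absorbs the factor \<open>1 - X\<close> of the
  recurrence.\<close>

lemma AL_gf_product_odd:
  assumes "product_formula (m + 1) (2 * j) 1 0 (m + 1) (m + 2) (AL_gf (m + 1) (2 * j))"
  shows "product_formula m (2 * j + 1) 1 0 m (m + 1) (AL_gf m (2 * j + 1))"
proof -
  have "product_formula (m + 1) (2 * j) 2 1 m (m + 1) (AL_gf' (m + 1) (2 * j))"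
    using assms product_formula_AL_gf'[of "m + 1" "2 * j"] by simp
  moreover have "qpochhammer (mono2 1 0) (mono2 1 1) (Suc j) =
      (1 - X) * qpochhammer (mono2 2 1) (mono2 1 1) j"
    by (simp add: qpochhammer_Suc_shift mono2_mult X_eq_mono2 numeral_2_eq_2)
  ultimately show ?thesis
    using AL_gf_odd[of "2 * j" m, symmetric]
    by (simp add: product_formula_def mult_ac)
qed

text \<open>Besides absorbing \<open>1 - X\<close>, one multiplies by \<open>1 - q^(j+1)\<close>,
  which extends both \<open>(q; q)_j\<close> and \<open>(q^(j+2); q)_j\<close> by one
  factor.\<close>

lemma AL_gf_product_even_0:
  assumes "product_formula 1 (2 * j + 1) 1 0 1 2 (AL_gf 1 (2 * j + 1))"
  shows "product_formula 0 (2 * j + 2) 1 0 0 1 (AL_gf 0 (2 * j + 2))"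
proof -
  define K where "K = gen_fun (AL 1 (2 * j + 1)) esum osum"
  define q where "q = mono2 1 1"
  have "product_formula 1 (2 * j + 1) 0 1 2 1 K"
    using assms product_formula_swap[of 1 "2 * j + 1"] by (simp add: K_def numeral_2_eq_2)
  then have K: "K * qpochhammer (mono2 0 1) q (Suc j) * qpochhammer (mono2 2 1) q j
      * qpochhammer q q j = qpochhammer (q ^ (j + 2)) q j"
    by (simp add: product_formula_def q_def)
  have x: "qpochhammer (mono2 1 0) q (Suc j) = (1 - X) * qpochhammer (mono2 2 1) q j"
    by (simp add: qpochhammer_Suc_shift mono2_mult X_eq_mono2 q_def numeral_2_eq_2)
  have "(1 - X) * AL_gf 0 (2 * j + 2) = K"
    using AL_gf_0[of "2 * j + 1"] by (simp add: K_def)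
  then have "AL_gf 0 (2 * j + 2) * qpochhammer (mono2 1 0) q (Suc j)
      * qpochhammer (mono2 0 1) q (Suc j) * qpochhammer q q (Suc j) =
      (K * qpochhammer (mono2 0 1) q (Suc j) * qpochhammer (mono2 2 1) q j
        * qpochhammer q q j) * (1 - q ^ Suc j)"
    unfolding x qpochhammer_Suc[of q q j] by (simp add: mult_ac)
  also have "\<dots> = qpochhammer (q ^ Suc j) q (Suc j)"
    unfolding K qpochhammer_Suc_shift[of "q ^ Suc j"] by (simp add: mult_ac)
  finally show ?thesis
    by (simp add: product_formula_def q_def)
qed

lemma AL_gf_product_even_Suc:
  assumes "product_formula m (2 * j + 2) 1 0 m (m + 1) (AL_gf m (2 * j + 2))"
    and "product_formula (m + 1) (2 * j + 1) 1 0 (m + 1) (m + 2) (AL_gf (m + 1) (2 * j + 1))"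
  shows "product_formula (m + 1) (2 * j + 2) 1 0 (m + 1) (m + 2) (AL_gf (m + 1) (2 * j + 2))"
proof -
  define q where "q = mono2 1 1"
  define v where "v = mono2 m (m + 1)"
  define F where "F = AL_gf m (2 * j + 2)"
  define G where "G = AL_gf' (m + 1) (2 * j + 2)"
  define H where "H = AL_gf' (m + 1) (2 * j + 1)"
  \<comment> \<open>The denominators in the formula sought for \<open>G\<close>.\<close>
  define Z where "Z = qpochhammer (mono2 2 1) q (Suc j) * qpochhammer v q (Suc j)
    * qpochhammer q q (Suc j)"
  define W where "W = qpochhammer (q ^ (m + j + 2)) q j"
  have F: "F * qpochhammer (mono2 1 0) q (Suc j) * qpochhammer v q (Suc j)
      * qpochhammer q q (Suc j) = (1 - q ^ (m + j + 1)) * W"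
  proof -
    have "qpochhammer (q ^ (m + Suc j)) q (Suc j) = (1 - q ^ (m + j + 1)) * W"
      unfolding W_def qpochhammer_Suc_shift[of "q ^ (m + Suc j)"] by (simp add: mult_ac)
    then show ?thesis
      using assms(1) by (simp add: product_formula_def q_def v_def F_def)
  qed
  have "product_formula (m + 1) (2 * j + 1) 2 1 m (m + 1) H"
    using assms(2) product_formula_AL_gf'[of "m + 1" "2 * j + 1"] by (simp add: H_def)
  then have H: "H * qpochhammer (mono2 2 1) q (Suc j) * qpochhammer v q j * qpochhammer q q j = W"
    by (simp add: product_formula_def q_def v_def W_def)
  have rec: "(1 - X) * G = (1 - X) * F - X * H"
    using AL_gf_even[of "2 * j + 1" m] by (simp add: F_def G_def H_def)
  have "(1 - X) * qpochhammer (mono2 2 1) q (Suc j) = qpochhammer (mono2 1 0) q (Suc (Suc j))"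
    by (subst qpochhammer_Suc_shift[of "mono2 1 0"])
      (simp add: mono2_mult X_eq_mono2 q_def numeral_2_eq_2)
  also have "\<dots> = qpochhammer (mono2 1 0) q (Suc j) * (1 - X * q ^ Suc j)"
    unfolding qpochhammer_Suc[of "mono2 1 0" q "Suc j"] X_eq_mono2 ..
  finally have x: "(1 - X) * qpochhammer (mono2 2 1) q (Suc j) =
      qpochhammer (mono2 1 0) q (Suc j) * (1 - X * q ^ Suc j)" .
  have "(1 - X) * F * Z = F * ((1 - X) * qpochhammer (mono2 2 1) q (Suc j))
      * qpochhammer v q (Suc j) * qpochhammer q q (Suc j)"
    by (simp add: Z_def mult_ac)
  also have "\<dots> = (F * qpochhammer (mono2 1 0) q (Suc j) * qpochhammer v q (Suc j)
      * qpochhammer q q (Suc j)) * (1 - X * q ^ Suc j)"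
    unfolding x by (simp add: mult_ac)
  finally have FZ: "(1 - X) * F * Z = (1 - q ^ (m + j + 1)) * W * (1 - X * q ^ Suc j)"
    unfolding F .
  have "H * Z = (H * qpochhammer (mono2 2 1) q (Suc j) * qpochhammer v q j * qpochhammer q q j)
      * ((1 - v * q ^ j) * (1 - q ^ Suc j))"
    unfolding Z_def qpochhammer_Suc[of v q j] qpochhammer_Suc[of q q j] by (simp add: mult_ac)
  then have "X * H * Z = X * (W * ((1 - v * q ^ j) * (1 - q ^ Suc j)))"
    unfolding H by (simp only: mult.assoc)
  then have HZ: "X * H * Z = W * ((X - X * v * q ^ j) * (1 - q ^ Suc j))"
    by (simp add: algebra_simps)
  have Xv: "X * v * q ^ j = q ^ (m + j + 1)"
    by (simp add: X_eq_mono2 v_def q_def mono2_mult mono2_power)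
  have "(1 - X) * (G * Z) = (1 - X) * F * Z - X * H * Z"
    unfolding mult.assoc[symmetric] rec by (rule left_diff_distrib)
  also have "\<dots> = (1 - X) * (W * (1 - q ^ (m + 2 * j + 2)))"
  proof -
    have "q ^ (m + 2 * j + 2) = q ^ (m + j + 1) * q ^ Suc j"
      by (subst power_add[symmetric]) (simp add: mult_2 add.assoc)
    \<comment> \<open>Used with \<open>a = q^(m+j+1) = x v q^j\<close> and
      \<open>b = q^(j+1)\<close>.\<close>
    moreover have "(1 - a) * W * (1 - X * b) - W * ((X - a) * (1 - b)) = (1 - X) * (W * (1 - a * b))"
      for a b
      by (simp add: algebra_simps)
    ultimately show ?thesis
      unfolding FZ HZ Xv by (simp only:)
  qed
  finally have "G * Z = W * (1 - q ^ (m + 2 * j + 2))"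
    using one_minus_X_neq_0 by simp
  also have "\<dots> = qpochhammer (q ^ (m + j + 2)) q (Suc j)"
    unfolding W_def qpochhammer_Suc power_add[symmetric] by (simp add: mult_2 add_ac)
  finally have "product_formula (m + 1) (2 * j + 2) 2 1 m (m + 1) G"
    by (simp add: product_formula_def Z_def q_def v_def mult_ac)
  then show ?thesis
    using product_formula_AL_gf'[of "m + 1" "2 * j + 2"] by (simp add: G_def)
qed

text \<open>Length \<open>2j+1\<close> at \<open>m\<close> reduces to length \<open>2j\<close> at
  \<open>m+1\<close>. Length \<open>2j+2\<close> is reached by an inner induction on
  \<open>m\<close> from \<open>m = 0\<close>, using length \<open>2j+1\<close> at every
  \<open>m\<close>.\<close>

lemma AL_gf_product: "product_formula m k 1 0 m (m + 1) (AL_gf m k)"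
proof -
  have "product_formula m (2 * j) 1 0 m (m + 1) (AL_gf m (2 * j))" for j m
  proof (induction j arbitrary: m)
    case 0
    have "AL m 0 = {[]}" by (auto simp: AL_def)
    then have "AL_gf m 0 = 1"
      by (auto simp: gen_fun_def fps_eq_iff if_distrib cong: conj_cong)
    then show ?case by (simp add: product_formula_def qpochhammer_def)
  next
    case (Suc j)
    have odd: "product_formula m (2 * j + 1) 1 0 m (m + 1) (AL_gf m (2 * j + 1))" for m
      using AL_gf_product_odd[of m j] Suc[of "m + 1"] by simp
    show ?case
    proof (induction m)
      case 0
      then show ?case using AL_gf_product_even_0[of j] odd[of 1] by (simp add: numeral_2_eq_2)
    next
      case (Suc m)
      then show ?case using AL_gf_product_even_Suc[of m j] odd[of "m + 1"] by simp
    qed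
  qed
  then show ?thesis
    using AL_gf_product_odd[of m "k div 2"] by (cases "even k") (auto elim!: evenE oddE)
qed

section \<open>Return to the quotient\<close>

lemma qpochhammer_nth_0:
  assumes "a $ 0 $ 0 = 0"
  shows "qpochhammer (a :: fps2) q r $ 0 $ 0 = 1"
  using assms by (induction r) (simp_all add: qpochhammer_def fps_mult_nth_0)

theorem theorem4:
  fixes n k :: nat
  assumes "int n \<ge> int k - 1"
  shows "anti_lecture_hall_gf n k =
           gauss_binomial n (k div 2) (X * Y) /
           (qpochhammer X (X * Y) ((k + 1) div 2) *
            qpochhammer (X ^ (n + 1 - k) * Y ^ (n + 2 - k)) (X * Y) (k div 2))"
proof -
  define m where "m = n + 1 - k"
  have k: "k \<le> n + 1" using assms by linarith
  \<comment> \<open>The second equation matches the exponent in \<open>gauss_binomial\<close>;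
    \<open>k \<le> n + 1\<close> prevents truncation.\<close>
  have e: "n + 2 - k = m + 1" "n + 1 - k div 2 = m + (k + 1) div 2"
    using k by (auto simp: m_def)
  define P where "P = qpochhammer X (X * Y) ((k + 1) div 2)"
  define Q where "Q = qpochhammer (X ^ m * Y ^ (m + 1)) (X * Y) (k div 2)"
  define R where "R = qpochhammer (X * Y) (X * Y) (k div 2)"
  define N where "N = qpochhammer ((X * Y) ^ (m + (k + 1) div 2)) (X * Y) (k div 2)"
  have unit: "P $ 0 $ 0 = 1" "Q $ 0 $ 0 = 1" "R $ 0 $ 0 = 1"
    unfolding P_def Q_def R_def
    by (intro qpochhammer_nth_0; simp add: X_def Y_def fps_mult_nth_0 fps_const_power)+
  have F: "AL_gf m k * P * Q * R = N"
    using AL_gf_product[of m k]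
    by (simp add: product_formula_def P_def Q_def R_def N_def mono2_def)
  \<comment> \<open>The constant terms are \<open>1\<close>, so both divisions are genuine.\<close>
  have "N div R * R = N" "N div R / (P * Q) * (P * Q) = N div R"
    by (rule fps2_divide_unit, simp add: unit fps_mult_nth_0)+
  then have "AL_gf m k * (P * Q * R) = N div R / (P * Q) * (P * Q * R)"
    using F by (metis mult.assoc)
  moreover have "P * Q * R \<noteq> 0"
    using unit by auto
  ultimately have "AL_gf m k = N div R / (P * Q)"
    by simp
  then show ?thesis
    unfolding anti_lecture_hall_gf_def truncated_anti_lecture_hall_eq_AL[OF k]
      gauss_binomial_def e P_def Q_def R_def N_def m_def[symmetric] .
qed

end
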